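(* Let $\mathbb{E}$ be a (finite-dimensional) Euclidean space, let $f\in\Gamma_0(\mathbb{E})$ and fix $(x,\lambda)\in\mathbb{E}\times\mathbb{R}_{++}$. Let $P_f(x,\lambda):=P_\lambda f(x)$ for $(x,\lambda)\in\mathbb{E}\times\mathbb{R}_{++}$. If $\partial f$ is proto-differentiable at $\left(P_f(x,\lambda),\ \frac1\lambda[x-P_f(x,\lambda)]\right)$, then $P_f$ is directionally differentiable at $(x,\lambda)$ with $$P_f'((x,\lambda);(d,\Delta))=\left[\lambda D(\partial f)\left(P_f(x,\lambda)\,\big|\,\tfrac1\lambda[x-P_f(x,\lambda)]\right)+I\right]^{-1}\left(d-\Delta\tfrac1\lambda[x-P_f(x,\lambda)]\right)$$ for all $(d,\Delta)\in\mathbb{E}\times\mathbb{R}$. In particular, for any $\lambda>0$ (under this proto-differentiability condition), $$(P_\lambda f)'(x;\cdot)=\left[\lambda D(\partial f)\left(P_f(x,\lambda)\,\big|\,\tfrac1\lambda[x-P_f(x,\lambda)]\right)+I\right]^{-1}(\cdot).$$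
   Context: $\Gamma_0(\mathbb{E})$ denotes the closed proper convex functions $\mathbb{E}\to\mathbb{R}\cup\{+\infty\}$; $\mathbb{R}_{++}=(0,\infty)$. For $\lambda>0$, $P_\lambda f(x)=\mathrm{argmin}_{u\in\mathbb{E}}\{f(u)+\frac1{2\lambda}\|x-u\|^2\}$. For a set-valued map $S:\mathbb{E}_1\rightrightarrows\mathbb{E}_2$ and $(\bar x,\bar u)\in\mathrm{gph}\,S$, the graphical derivative $DS(\bar x|\bar u)$ is the set-valued map with $v\in DS(\bar x|\bar u)(w)$ iff $(w,v)\in T_{\mathrm{gph}S}(\bar x,\bar u)$, where $T_A(\bar a)$ is the set of all $z$ for which there exist $t_k\downarrow0$, $z_k\to z$ with $\bar a+t_kz_k\in A$. $S$ is proto-differentiable at $(\bar x,\bar u)\in\mathrm{gph}\,S$ if for any $\bar z\in DS(\bar x|\bar u)(\bar w)$ and any $t_k\downarrow0$ there exist $w_k\to\bar w$, $z_k\to\bar z$ with $z_k\in(S(\bar x+t_kw_k)-\bar u)/t_k$ for all $k$. $[\cdot]^{-1}$ denotes the inverse of the set-valued map $w\mapsto\lambda D(\partial f)(\cdot|\cdot)(w)+w$, and singletons are identified with their elements. *)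

theory Defs
  imports "HOL-Analysis.Analysis"
begin

definition ereal_epigraph :: "('a \<Rightarrow> ereal) \<Rightarrow> ('a \<times> real) set" where
  "ereal_epigraph f = {(x, r). f x \<le> ereal r}"

definition closed_proper_convex :: "('a::euclidean_space \<Rightarrow> ereal) \<Rightarrow> bool" where
  "closed_proper_convex f \<longleftrightarrow>
     closed (ereal_epigraph f) \<and> convex (ereal_epigraph f) \<and>
     (\<forall>x. f x \<noteq> -\<infinity>) \<and> (\<exists>x. f x \<noteq> \<infinity>)"

definition subdifferential :: "('a::euclidean_space \<Rightarrow> ereal) \<Rightarrow> 'a \<Rightarrow> 'a set" where
  "subdifferential f x =
     {v. \<bar>f x\<bar> \<noteq> \<infinity> \<and> (\<forall>y. f x + ereal (v \<bullet> (y - x)) \<le> f y)}"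

definition prox_argmin :: "real \<Rightarrow> ('a::euclidean_space \<Rightarrow> ereal) \<Rightarrow> 'a \<Rightarrow> 'a set" where
  "prox_argmin lam f x =
     {u. is_arg_min (\<lambda>u. f u + ereal (1 / (2 * lam) * (norm (x - u))\<^sup>2)) (\<lambda>_. True) u}"

text \<open>For closed proper convex \<open>f\<close> and \<open>lam > 0\<close> the set of minimizers is a singleton, and
  \<open>prox lam f x\<close> is its element; where it is not a singleton the value is unspecified.\<close>

definition prox :: "real \<Rightarrow> ('a::euclidean_space \<Rightarrow> ereal) \<Rightarrow> 'a \<Rightarrow> 'a" where
  "prox lam f x = the_elem (prox_argmin lam f x)"

definition joint_prox :: "('a::euclidean_space \<Rightarrow> ereal) \<Rightarrow> 'a \<times> real \<Rightarrow> 'a" where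
  "joint_prox f = (\<lambda>(x, lam). prox lam f x)"

definition set_graph :: "('a \<Rightarrow> 'b set) \<Rightarrow> ('a \<times> 'b) set" where
  "set_graph S = {(x, u). u \<in> S x}"

definition set_inverse :: "('a \<Rightarrow> 'b set) \<Rightarrow> 'b \<Rightarrow> 'a set" where
  "set_inverse S u = {x. u \<in> S x}"

text \<open>\<open>t\<^sub>k \<down> 0\<close> means that \<open>t\<^sub>k\<close> tends to zero through positive values; monotonicity is
  not required.\<close>

definition down_to_zero :: "(nat \<Rightarrow> real) \<Rightarrow> bool" where
  "down_to_zero t \<longleftrightarrow> (\<forall>k. t k > 0) \<and> t \<longlonglongrightarrow> 0"

definition tangent_cone :: "'a::real_normed_vector set \<Rightarrow> 'a \<Rightarrow> 'a set" where
  "tangent_cone A a =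
     {z. \<exists>t zs. down_to_zero t \<and> zs \<longlonglongrightarrow> z \<and> (\<forall>k. a + t k *\<^sub>R zs k \<in> A)}"

definition graphical_deriv ::
  "('a::euclidean_space \<Rightarrow> 'b::euclidean_space set) \<Rightarrow> 'a \<Rightarrow> 'b \<Rightarrow> 'a \<Rightarrow> 'b set" where
  "graphical_deriv S x u w = {v. (w, v) \<in> tangent_cone (set_graph S) (x, u)}"

definition proto_differentiable ::
  "('a::euclidean_space \<Rightarrow> 'b::euclidean_space set) \<Rightarrow> 'a \<Rightarrow> 'b \<Rightarrow> bool" where
  "proto_differentiable S x u \<longleftrightarrow>
     (x, u) \<in> set_graph S \<and>
     (\<forall>w z t. z \<in> graphical_deriv S x u w \<and> down_to_zero t \<longrightarrow>
        (\<exists>ws zs. ws \<longlonglongrightarrow> w \<and> zs \<longlonglongrightarrow> z \<and>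
          (\<forall>k. zs k \<in> (\<lambda>y. (y - u) /\<^sub>R t k) ` S (x + t k *\<^sub>R ws k))))"

definition scale_plus_id :: "real \<Rightarrow> ('a::real_vector \<Rightarrow> 'a set) \<Rightarrow> 'a \<Rightarrow> 'a set" where
  "scale_plus_id lam D w = (\<lambda>z. lam *\<^sub>R z + w) ` D w"

definition has_dir_deriv ::
  "('a::real_normed_vector \<Rightarrow> 'b::real_normed_vector) \<Rightarrow> 'a \<Rightarrow> 'a \<Rightarrow> 'b \<Rightarrow> bool" where
  "has_dir_deriv F x d v \<longleftrightarrow>
     ((\<lambda>t. (F (x + t *\<^sub>R d) - F x) /\<^sub>R t) \<longlongrightarrow> v) (at_right 0)"

definition dir_differentiable ::
  "('a::real_normed_vector \<Rightarrow> 'b::real_normed_vector) \<Rightarrow> 'a \<Rightarrow> bool" where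
  "dir_differentiable F x \<longleftrightarrow> (\<forall>d. \<exists>v. has_dir_deriv F x d v)"

definition dir_deriv ::
  "('a::real_normed_vector \<Rightarrow> 'b::real_normed_vector) \<Rightarrow> 'a \<Rightarrow> 'a \<Rightarrow> 'b" where
  "dir_deriv F x d = (THE v. has_dir_deriv F x d v)"

end

theory Submission
  imports Defs
begin

text \<open>
  Put \<open>p = P_f(x, \<lambda>)\<close> and \<open>u = (x - p) / \<lambda>\<close>.  Convexity turns the minimality of \<open>p\<close> into the
  inclusion \<open>u \<in> \<partial>f(p)\<close> (\<open>argmin_subgradient\<close>), and \<open>\<partial>f\<close> is monotone.  Let \<open>t > 0\<close> be small
  and let \<open>p\<^sub>t\<close>, \<open>u\<^sub>t\<close> be the corresponding points for \<open>(x + t d, \<lambda> + t \<Delta>)\<close>.  The difference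
  quotients \<open>w\<^sub>t = (p\<^sub>t - p) / t\<close> and \<open>v\<^sub>t = (u\<^sub>t - u) / t\<close> satisfy
  \<open>(\<lambda> + t \<Delta>) v\<^sub>t + w\<^sub>t = e\<close>, where \<open>e = d - \<Delta> u\<close>.

  Everything else comes from one inequality (\<open>norm_le_of_monotone\<close>): if \<open>\<mu> b + a = e\<close> with
  \<open>\<mu> > 0\<close> and \<open>\<langle>b, a\<rangle> \<ge> 0\<close>, then \<open>\<parallel>a\<parallel> \<le> \<parallel>e\<parallel>\<close>.  It bounds \<open>w\<^sub>t\<close>, so \<open>w\<^sub>t\<close> has a cluster
  point \<open>w\<close> as \<open>t \<down> 0\<close>, and then \<open>(w, (e - w) / \<lambda>)\<close> is tangent to the graph of \<open>\<partial>f\<close>; hence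
  \<open>w\<close> belongs to \<open>[\<lambda> D(\<partial>f) + I]\<^sup>-\<^sup>1(e)\<close>.  Conversely, let \<open>w\<close> be any element of that set, with
  \<open>v \<in> D(\<partial>f)(w)\<close> and \<open>\<lambda> v + w = e\<close>.  Proto-differentiability approximates \<open>(w, v)\<close> by
  difference quotients \<open>(w'\<^sub>k, v'\<^sub>k)\<close> of \<open>\<partial>f\<close> along every prescribed sequence \<open>t\<^sub>k \<down> 0\<close>.
  By monotonicity the inequality applies to \<open>a = w\<^sub>t - w'\<^sub>k\<close>, \<open>b = v\<^sub>t - v'\<^sub>k\<close> at \<open>t = t\<^sub>k\<close>,
  where the right-hand side is \<open>e - ((\<lambda> + t\<^sub>k \<Delta>) v'\<^sub>k + w'\<^sub>k) \<rightarrow> 0\<close>.  Hence \<open>w\<^sub>t - w'\<^sub>k \<rightarrow> 0\<close>, so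
  that \<open>w\<^sub>t \<rightarrow> w\<close> along \<open>t\<^sub>k\<close>.  Thus every element of the set is the directional
  derivative, and the set is a singleton.  The statement for fixed \<open>\<lambda>\<close> is the case \<open>\<Delta> = 0\<close>.
\<close>

section \<open>Existence and uniqueness of the proximal point\<close>

text \<open>A strict separation of the epigraph from a point below it is not vertical, because that
  point lies below a point of the epigraph; it therefore yields an affine minorant.\<close>

lemma closed_proper_convex_affine_minorant:
  fixes f :: "'a::euclidean_space \<Rightarrow> ereal"
  assumes "closed_proper_convex f"
  obtains v b where "\<And>y r. f y \<le> ereal r \<Longrightarrow> v \<bullet> y + b \<le> r"
proof -
  obtain x0 where "f x0 \<noteq> \<infinity>" and fin: "\<And>x. f x \<noteq> -\<infinity>"
    using assms by (auto simp: closed_proper_convex_def)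
  then obtain r0 where r0: "f x0 = ereal r0"
    by (cases "f x0") auto
  have cl: "closed (ereal_epigraph f)" and cv: "convex (ereal_epigraph f)"
    using assms by (auto simp: closed_proper_convex_def)
  have "(x0, r0 - 1) \<notin> ereal_epigraph f"
    by (simp add: ereal_epigraph_def r0)
  then obtain a c where low: "a \<bullet> (x0, r0 - 1) < c"
    and up: "\<And>z. z \<in> ereal_epigraph f \<Longrightarrow> c < a \<bullet> z"
    using separating_hyperplane_closed_point[OF cv cl] by metis
  obtain v s where a: "a = (v, s)" by (cases a)
  have up': "c < v \<bullet> y + s * r" if "f y \<le> ereal r" for y r
    using up[of "(y, r)"] that by (simp add: ereal_epigraph_def a)
  have "v \<bullet> x0 + s * (r0 - 1) < v \<bullet> x0 + s * r0"
    using low up'[of x0 r0] by (simp add: a r0)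
  then have s: "s > 0" by (simp add: algebra_simps)
  show thesis
  proof (rule that)
    fix y r assume "f y \<le> ereal r"
    then have "c - v \<bullet> y \<le> s * r" using up'[of y r] by simp
    then have "(c - v \<bullet> y) / s \<le> r"
      using s by (simp add: divide_le_eq mult.commute)
    then show "(- (v /\<^sub>R s)) \<bullet> y + c / s \<le> r"
      using s by (simp add: diff_divide_distrib divide_inverse algebra_simps)
  qed
qed

text \<open>The minimum is attained by minimizing \<open>r + \<parallel>x - y\<parallel>\<^sup>2 / (2 \<lambda>)\<close> over the points \<open>(y, r)\<close> of the
  epigraph.  This replaces the lower semicontinuous \<open>f\<close> by a continuous function on a closed set,
  whose sublevel sets are bounded because the quadratic term dominates the affine minorant.\<close>

lemma prox_argmin_nonempty:
  fixes f :: "'a::euclidean_space \<Rightarrow> ereal"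
  assumes f: "closed_proper_convex f" and lam: "lam > 0"
  shows "prox_argmin lam f x \<noteq> {}"
proof -
  obtain v b where minor: "\<And>y r. f y \<le> ereal r \<Longrightarrow> v \<bullet> y + b \<le> r"
    using closed_proper_convex_affine_minorant[OF f] by blast
  obtain x0 where "f x0 \<noteq> \<infinity>" and fin: "\<And>x. f x \<noteq> -\<infinity>"
    using f by (auto simp: closed_proper_convex_def)
  then obtain r0 where r0: "f x0 = ereal r0"
    by (cases "f x0") auto
  define \<phi> where "\<phi> = (\<lambda>z :: 'a \<times> real. snd z + 1 / (2 * lam) * (norm (x - fst z))\<^sup>2)"
  define M where "M = \<phi> (x0, r0)"
  define S where "S = ereal_epigraph f \<inter> {z. \<phi> z \<le> M}"
  have cont: "continuous_on A \<phi>" for A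
    unfolding \<phi>_def by (intro continuous_intros)
  define K where "K = 2 * lam * norm v"
  define L where "L = \<bar>2 * lam * (M - b - v \<bullet> x)\<bar>"
  define R where "R = K + L + 1"
  have "S \<subseteq> cball x R \<times> {b - norm v * (norm x + R)..M}"
  proof
    fix z assume z: "z \<in> S"
    obtain u r where zu: "z = (u, r)" by (cases z)
    have r: "f u \<le> ereal r" and le: "r + 1 / (2 * lam) * (norm (x - u))\<^sup>2 \<le> M"
      using z by (auto simp: S_def zu \<phi>_def ereal_epigraph_def)
    have vb: "v \<bullet> u + b \<le> r" using minor r by blast
    define n where "n = norm (x - u)"
    have "v \<bullet> (x - u) \<le> norm v * n"
      unfolding n_def by (rule norm_cauchy_schwarz)
    then have "v \<bullet> x \<le> v \<bullet> u + norm v * n" by (simp add: inner_diff_right)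
    then have "1 / (2 * lam) * n\<^sup>2 \<le> (M - b - v \<bullet> x) + norm v * n"
      using vb le by (simp add: n_def)
    then have "n\<^sup>2 \<le> 2 * lam * ((M - b - v \<bullet> x) + norm v * n)"
      using lam by (simp add: field_simps)
    also have "\<dots> = 2 * lam * (M - b - v \<bullet> x) + K * n"
      by (simp add: K_def algebra_simps)
    also have "\<dots> \<le> L + K * n" by (simp add: L_def)
    finally have quad: "n * (n - K) \<le> L" by (simp add: power2_eq_square algebra_simps)
    have "K \<ge> 0" "L \<ge> 0" using lam by (simp_all add: K_def L_def)
    have n: "n \<le> R"
    proof (rule ccontr)
      assume "\<not> n \<le> R"
      then have "n \<ge> 1" "n - K \<ge> L + 1"
        using \<open>K \<ge> 0\<close> \<open>L \<ge> 0\<close> by (simp_all add: R_def)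
      then have "1 * (L + 1) \<le> n * (n - K)"
        using \<open>L \<ge> 0\<close> by (intro mult_mono) auto
      then show False using quad by simp
    qed
    have "norm u \<le> norm x + R"
      using n norm_triangle_ineq2[of u x] by (simp add: n_def norm_minus_commute)
    then have "norm v * norm u \<le> norm v * (norm x + R)"
      by (intro mult_left_mono) auto
    moreover have "- (v \<bullet> u) \<le> norm v * norm u"
      using norm_cauchy_schwarz[of v "- u"] by simp
    ultimately have "b - norm v * (norm x + R) \<le> r" using vb by linarith
    moreover have "0 \<le> 1 / (2 * lam) * (norm (x - u))\<^sup>2" using lam by simp
    then have "r \<le> M" using le by linarith
    ultimately show "z \<in> cball x R \<times> {b - norm v * (norm x + R)..M}"
      using n by (simp add: zu n_def dist_norm)
  qed
  then have "bounded S"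
    by (rule bounded_subset[rotated]) (intro bounded_Times bounded_cball bounded_closed_interval)
  moreover have "closed S"
    using f unfolding S_def closed_proper_convex_def
    by (intro closed_Int closed_Collect_le cont continuous_on_const) auto
  ultimately have "compact S" by (simp add: compact_eq_bounded_closed)
  moreover have "(x0, r0) \<in> S" by (simp add: S_def M_def ereal_epigraph_def r0)
  ultimately obtain z where z: "z \<in> S" and zmin: "\<And>z'. z' \<in> S \<Longrightarrow> \<phi> z \<le> \<phi> z'"
    using continuous_attains_inf[OF _ _ cont, of S] by blast
  have glob: "\<phi> z \<le> \<phi> z'" if "z' \<in> ereal_epigraph f" for z'
    using zmin[of z'] zmin[OF \<open>(x0, r0) \<in> S\<close>] that by (fastforce simp: S_def M_def)
  have zf: "f (fst z) \<le> ereal (snd z)"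
    using z by (auto simp: S_def ereal_epigraph_def)
  have "f (fst z) + ereal (1 / (2 * lam) * (norm (x - fst z))\<^sup>2)
        \<le> f y + ereal (1 / (2 * lam) * (norm (x - y))\<^sup>2)" for y
  proof (cases "f y")
    case (real r)
    have "f (fst z) + ereal (1 / (2 * lam) * (norm (x - fst z))\<^sup>2) \<le> ereal (\<phi> z)"
      using add_right_mono[OF zf, of "ereal (1 / (2 * lam) * (norm (x - fst z))\<^sup>2)"]
      by (simp add: \<phi>_def)
    also have "\<dots> \<le> ereal (\<phi> (y, r))"
      using glob[of "(y, r)"] real by (simp add: ereal_epigraph_def)
    finally show ?thesis by (simp add: real \<phi>_def)
  qed (use fin in auto)
  then have "fst z \<in> prox_argmin lam f x"
    by (simp add: prox_argmin_def is_arg_min_def not_less)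
  then show ?thesis by blast
qed

text \<open>First-order optimality: comparing the objective at \<open>p\<close> with its value at
  \<open>p + s (y - p)\<close>, dividing by \<open>s\<close> and letting \<open>s \<down> 0\<close> gives the subgradient inequality.\<close>

lemma argmin_subgradient:
  fixes f :: "'a::euclidean_space \<Rightarrow> ereal"
  assumes f: "closed_proper_convex f" and lam: "lam > 0" and p: "p \<in> prox_argmin lam f x"
  shows "(1 / lam) *\<^sub>R (x - p) \<in> subdifferential f p"
proof -
  have cv: "convex (ereal_epigraph f)" and fin: "\<And>x. f x \<noteq> -\<infinity>"
    using f by (auto simp: closed_proper_convex_def)
  obtain x0 where x0: "f x0 \<noteq> \<infinity>"
    using f by (auto simp: closed_proper_convex_def)
  have pmin: "f p + ereal (1 / (2 * lam) * (norm (x - p))\<^sup>2)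
        \<le> f y + ereal (1 / (2 * lam) * (norm (x - y))\<^sup>2)" for y
    using p by (simp add: prox_argmin_def is_arg_min_def not_less)
  have "f p \<noteq> \<infinity>" using pmin[of x0] x0 by auto
  then obtain a where a: "f p = ereal a" using fin[of p] by (cases "f p") auto
  have "f p + ereal (((1 / lam) *\<^sub>R (x - p)) \<bullet> (y - p)) \<le> f y" for y
  proof (cases "f y")
    case (real r)
    define g where "g = (x - p) \<bullet> (y - p)"
    define N where "N = (norm (y - p))\<^sup>2"
    have ineq: "a + g / lam \<le> r + s * (N / (2 * lam))" if s: "0 < s" "s \<le> 1" for s
    proof -
      define q where "q = (1 - s) *\<^sub>R p + s *\<^sub>R y"
      have "(1 - s) *\<^sub>R (p, a) + s *\<^sub>R (y, r) \<in> ereal_epigraph f"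
        using s by (intro convexD[OF cv]) (auto simp: ereal_epigraph_def a real)
      then have "f q \<le> ereal ((1 - s) * a + s * r)"
        by (simp add: ereal_epigraph_def q_def)
      from order_trans[OF pmin[of q] add_right_mono[OF this]]
      have le: "a + 1 / (2 * lam) * (norm (x - p))\<^sup>2
          \<le> ((1 - s) * a + s * r) + 1 / (2 * lam) * (norm (x - q))\<^sup>2"
        by (simp add: a)
      have xq: "x - q = (x - p) - s *\<^sub>R (y - p)" by (simp add: q_def algebra_simps)
      have sq: "(norm (x - q))\<^sup>2 = (norm (x - p))\<^sup>2 - 2 * s * g + s\<^sup>2 * N"
        unfolding xq g_def N_def power2_norm_eq_inner
        by (simp add: inner_diff_left inner_diff_right inner_commute power2_eq_square algebra_simps)
      define c where "c = 1 / (2 * lam)"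
      have c: "g / lam = 2 * c * g" "N / (2 * lam) = c * N" by (simp_all add: c_def)
      have "s * (a + g / lam) \<le> s * (r + s * (N / (2 * lam)))"
        using le unfolding sq c c_def[symmetric]
        by (simp add: algebra_simps power2_eq_square)
      then show ?thesis using s by simp
    qed
    have "((\<lambda>s. r + s * (N / (2 * lam))) \<longlongrightarrow> r + 0 * (N / (2 * lam))) (at_right 0)"
      by (intro tendsto_intros)
    moreover have "eventually (\<lambda>s. a + g / lam \<le> r + s * (N / (2 * lam))) (at_right 0)"
      by (rule eventually_mono[OF eventually_at_right_real[of 0 1]]) (simp_all only: zero_less_one
          greaterThanLessThan_iff ineq less_imp_le)
    ultimately have "a + g / lam \<le> r + 0 * (N / (2 * lam))"
      by (intro tendsto_lowerbound) auto
    then show ?thesis by (simp add: a real g_def)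
  qed (use fin in auto)
  then show ?thesis by (simp add: subdifferential_def a)
qed

lemma subdifferential_monotone:
  assumes "u \<in> subdifferential f p" "v \<in> subdifferential f q"
  shows "0 \<le> (u - v) \<bullet> (p - q)"
proof -
  obtain a b where ab: "f p = ereal a" "f q = ereal b"
    using assms by (auto simp: subdifferential_def)
  have "f p + ereal (u \<bullet> (q - p)) \<le> f q" "f q + ereal (v \<bullet> (p - q)) \<le> f p"
    using assms by (auto simp: subdifferential_def)
  then have "a + u \<bullet> (q - p) \<le> b" "b + v \<bullet> (p - q) \<le> a"
    by (simp_all add: ab)
  then show ?thesis by (simp add: inner_diff_left inner_diff_right)
qed

text \<open>The quantitative form of the fact that the resolvent of a monotone map is nonexpansive.\<close>

lemma norm_le_of_monotone:
  fixes a b e :: "'a::real_inner"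
  assumes "\<mu> > 0" "0 \<le> b \<bullet> a" "\<mu> *\<^sub>R b + a = e"
  shows "norm a \<le> norm e"
proof -
  have "(norm a)\<^sup>2 \<le> \<mu> * (b \<bullet> a) + a \<bullet> a"
    using assms by (simp add: power2_norm_eq_inner)
  also have "\<dots> = e \<bullet> a"
    using assms(3) by (auto simp: inner_add_left)
  also have "\<dots> \<le> norm e * norm a" by (rule norm_cauchy_schwarz)
  finally show ?thesis
    by (cases "a = 0") (auto simp: power2_eq_square)
qed

lemma prox_subgradient:
  fixes f :: "'a::euclidean_space \<Rightarrow> ereal"
  assumes f: "closed_proper_convex f" and lam: "lam > 0"
  shows "(1 / lam) *\<^sub>R (x - prox lam f x) \<in> subdifferential f (prox lam f x)"
proof -
  obtain p where p: "p \<in> prox_argmin lam f x"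
    using prox_argmin_nonempty[OF f lam] by blast
  have "q = p" if "q \<in> prox_argmin lam f x" for q
  proof -
    have "0 \<le> ((1 / lam) *\<^sub>R (x - q) - (1 / lam) *\<^sub>R (x - p)) \<bullet> (q - p)"
      by (rule subdifferential_monotone[OF argmin_subgradient[OF f lam that] argmin_subgradient[OF f lam p]])
    then have "norm (q - p) \<le> norm (0 :: 'a)"
      by (rule norm_le_of_monotone[OF lam]) (use lam in \<open>simp add: scaleR_diff_right\<close>)
    then show ?thesis by simp
  qed
  then have "prox_argmin lam f x = {p}" using p by blast
  then have "prox lam f x = p" by (simp add: prox_def)
  then show ?thesis using argmin_subgradient[OF f lam p] by simp
qed

section \<open>Difference quotients of the proximal map\<close>

lemma joint_prox_subgradient:
  fixes f :: "'a::euclidean_space \<Rightarrow> ereal"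
  assumes "closed_proper_convex f" "lam > 0"
  shows "(1 / lam) *\<^sub>R (x - joint_prox f (x, lam)) \<in> subdifferential f (joint_prox f (x, lam))"
  using prox_subgradient[OF assms] by (simp add: joint_prox_def)

text \<open>The fundamental relation between the difference quotient \<open>w\<close> of the proximal points and
  the difference quotient \<open>v\<close> of the associated subgradients.\<close>

lemma joint_prox_quotient:
  fixes f :: "'a::euclidean_space \<Rightarrow> ereal" and x d :: 'a and lam \<Delta> t :: real
  assumes f: "closed_proper_convex f" and lam: "lam > 0"
    and t: "t > 0" and lamt: "lam + t * \<Delta> > 0"
  defines "p \<equiv> joint_prox f (x, lam)"
  defines "u \<equiv> (1 / lam) *\<^sub>R (x - p)"
  defines "w \<equiv> (joint_prox f ((x, lam) + t *\<^sub>R (d, \<Delta>)) - p) /\<^sub>R t"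
  defines "v \<equiv> (1 / (lam + t * \<Delta>)) *\<^sub>R (d - \<Delta> *\<^sub>R u - w)"
  shows "u + t *\<^sub>R v \<in> subdifferential f (p + t *\<^sub>R w)"
    and "(lam + t * \<Delta>) *\<^sub>R v + w = d - \<Delta> *\<^sub>R u"
proof -
  show "(lam + t * \<Delta>) *\<^sub>R v + w = d - \<Delta> *\<^sub>R u"
    using lamt by (simp add: v_def)
  define pt where "pt = joint_prox f (x + t *\<^sub>R d, lam + t * \<Delta>)"
  have pt: "p + t *\<^sub>R w = pt"
    using t by (simp add: w_def pt_def)
  have x: "x = p + lam *\<^sub>R u" using lam by (simp add: u_def)
  have "(lam + t * \<Delta>) *\<^sub>R (u + t *\<^sub>R v) = lam *\<^sub>R u + (t * \<Delta>) *\<^sub>R u + t *\<^sub>R (d - \<Delta> *\<^sub>R u - w)"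
    using lamt by (simp add: v_def scaleR_add_right scaleR_add_left)
  also have "\<dots> = x + t *\<^sub>R d - (p + t *\<^sub>R w)"
    by (subst x) (simp add: algebra_simps)
  finally have "x + t *\<^sub>R d - pt = (lam + t * \<Delta>) *\<^sub>R (u + t *\<^sub>R v)"
    by (simp only: pt)
  then have "(1 / (lam + t * \<Delta>)) *\<^sub>R (x + t *\<^sub>R d - pt) = u + t *\<^sub>R v"
    using lamt by simp
  then show "u + t *\<^sub>R v \<in> subdifferential f (p + t *\<^sub>R w)"
    using joint_prox_subgradient[OF f lamt, of "x + t *\<^sub>R d"] by (simp add: pt pt_def)
qed

lemma subdifferential_quotient_monotone:
  assumes "u + t *\<^sub>R v \<in> subdifferential f (p + t *\<^sub>R w)"
    and "u + t *\<^sub>R v' \<in> subdifferential f (p + t *\<^sub>R w')" and t: "t > 0"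
  shows "0 \<le> (v - v') \<bullet> (w - w')"
proof -
  have "0 \<le> ((u + t *\<^sub>R v) - (u + t *\<^sub>R v')) \<bullet> ((p + t *\<^sub>R w) - (p + t *\<^sub>R w'))"
    using assms(1,2) by (rule subdifferential_monotone)
  also have "\<dots> = (t *\<^sub>R (v - v')) \<bullet> (t *\<^sub>R (w - w'))" by (simp add: algebra_simps)
  also have "\<dots> = (t * t) * ((v - v') \<bullet> (w - w'))" by simp
  finally show ?thesis using mult_pos_pos[OF t t] by (simp only: zero_le_mult_iff) auto
qed

section \<open>The directional derivative\<close>

text \<open>Proto-differentiability provides difference quotients of \<open>\<partial>f\<close> converging to
  \<open>(w, v)\<close> along the step sizes at which the proximal map is being differentiated.\<close>

lemma has_dir_deriv_joint_prox:
  fixes f :: "'a::euclidean_space \<Rightarrow> ereal" and x d :: 'a and lam \<Delta> :: real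
  assumes f: "closed_proper_convex f" and lam: "lam > 0"
  defines "p \<equiv> joint_prox f (x, lam)"
  defines "u \<equiv> (1 / lam) *\<^sub>R (x - p)"
  assumes proto: "proto_differentiable (subdifferential f) p u"
    and v: "v \<in> graphical_deriv (subdifferential f) p u w"
    and eq: "lam *\<^sub>R v + w = d - \<Delta> *\<^sub>R u"
  shows "has_dir_deriv (joint_prox f) (x, lam) (d, \<Delta>) w"
proof -
  define W where "W t = (joint_prox f ((x, lam) + t *\<^sub>R (d, \<Delta>)) - p) /\<^sub>R t" for t
  have "(W \<longlongrightarrow> w) (at_right 0)"
    unfolding tendsto_at_iff_sequentially
  proof (intro allI impI)
    fix t :: "nat \<Rightarrow> real"
    assume "\<forall>i. t i \<in> {0<..} - {0}" and t0: "t \<longlonglongrightarrow> 0"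
    then have tpos: "\<And>i. t i > 0" by auto
    then have "down_to_zero t" using t0 by (simp add: down_to_zero_def)
    then obtain ws vs where ws: "ws \<longlonglongrightarrow> w" and vs: "vs \<longlonglongrightarrow> v"
      and q: "\<And>k. vs k \<in> (\<lambda>y. (y - u) /\<^sub>R t k) ` subdifferential f (p + t k *\<^sub>R ws k)"
      using proto v unfolding proto_differentiable_def by metis
    have q': "u + t k *\<^sub>R vs k \<in> subdifferential f (p + t k *\<^sub>R ws k)" for k
      using q[of k] tpos[of k] by auto
    \<comment> \<open>The defect of the approximating quotients in the exact relation that \<open>W (t k)\<close> satisfies.\<close>
    define \<epsilon> where "\<epsilon> k = (d - \<Delta> *\<^sub>R u) - ((lam + t k * \<Delta>) *\<^sub>R vs k + ws k)" for k
    have lim: "(\<lambda>k. lam + t k * \<Delta>) \<longlonglongrightarrow> lam + 0 * \<Delta>"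
      by (intro tendsto_intros t0)
    then have pos: "\<forall>\<^sub>F k in sequentially. lam + t k * \<Delta> > 0"
      by (rule order_tendstoD) (use lam in simp)
    have "\<epsilon> \<longlonglongrightarrow> (d - \<Delta> *\<^sub>R u) - ((lam + 0 * \<Delta>) *\<^sub>R v + w)"
      unfolding \<epsilon>_def by (intro tendsto_intros lim vs ws)
    then have \<epsilon>: "\<epsilon> \<longlonglongrightarrow> 0" using eq by simp
    have "\<forall>\<^sub>F k in sequentially. norm (W (t k) - ws k) \<le> norm (\<epsilon> k)"
      using pos
    proof eventually_elim
      case (elim k)
      note Q = joint_prox_quotient[OF f lam tpos[of k] elim, where x = x and d = d,
          folded p_def, folded u_def, folded W_def]
      show ?case
      proof (rule norm_le_of_monotone[OF elim])
        show "0 \<le> ((1 / (lam + t k * \<Delta>)) *\<^sub>R (d - \<Delta> *\<^sub>R u - W (t k)) - vs k) \<bullet> (W (t k) - ws k)"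
          by (rule subdifferential_quotient_monotone[OF Q(1) q' tpos])
        show "(lam + t k * \<Delta>) *\<^sub>R ((1 / (lam + t k * \<Delta>)) *\<^sub>R (d - \<Delta> *\<^sub>R u - W (t k)) - vs k)
            + (W (t k) - ws k) = \<epsilon> k"
          using Q(2) unfolding \<epsilon>_def scaleR_diff_right by (simp add: algebra_simps)
      qed
    qed
    then have "(\<lambda>k. W (t k) - ws k) \<longlonglongrightarrow> 0"
      by (rule Lim_null_comparison) (use \<epsilon> tendsto_norm_zero in blast)
    from tendsto_add[OF this ws] show "(W \<circ> t) \<longlonglongrightarrow> w" by (simp add: o_def)
  qed
  then show ?thesis unfolding has_dir_deriv_def W_def p_def .
qed

text \<open>Solvability of the inclusion, by compactness: a cluster point of the difference quotients
  of the proximal map solves it.\<close>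

lemma ex_graphical_deriv_solution:
  fixes f :: "'a::euclidean_space \<Rightarrow> ereal" and x d :: 'a and lam \<Delta> :: real
  assumes f: "closed_proper_convex f" and lam: "lam > 0"
  defines "p \<equiv> joint_prox f (x, lam)"
  defines "u \<equiv> (1 / lam) *\<^sub>R (x - p)"
  obtains w v where "v \<in> graphical_deriv (subdifferential f) p u w"
    and "lam *\<^sub>R v + w = d - \<Delta> *\<^sub>R u"
proof -
  define W where "W t = (joint_prox f ((x, lam) + t *\<^sub>R (d, \<Delta>)) - p) /\<^sub>R t" for t
  define V where "V t = (1 / (lam + t * \<Delta>)) *\<^sub>R (d - \<Delta> *\<^sub>R u - W t)" for t
  \<comment> \<open>Step sizes so small that the perturbed parameter stays positive for every index.\<close>
  define t where "t k = lam / (1 + \<bar>\<Delta>\<bar>) * inverse (real (Suc k))" for k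
  have tpos: "t k > 0" for k using lam by (simp add: t_def)
  have "t \<longlonglongrightarrow> lam / (1 + \<bar>\<Delta>\<bar>) * 0"
    unfolding t_def by (intro tendsto_intros LIMSEQ_inverse_real_of_nat)
  then have t0: "t \<longlonglongrightarrow> 0" by simp
  have lamt: "lam + t k * \<Delta> > 0" for k
  proof -
    have "t k \<le> lam / (1 + \<bar>\<Delta>\<bar>) * 1"
      unfolding t_def using lam by (intro mult_left_mono) (auto simp: field_simps)
    then have "t k * (1 + \<bar>\<Delta>\<bar>) \<le> lam" by (simp add: field_simps)
    moreover have "- (t k * \<Delta>) \<le> t k * \<bar>\<Delta>\<bar>"
      using tpos[of k] mult_left_mono[of "- \<Delta>" "\<bar>\<Delta>\<bar>" "t k"] by simp
    ultimately show ?thesis using tpos[of k] by (simp add: algebra_simps)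
  qed
  have Q1: "u + t k *\<^sub>R V (t k) \<in> subdifferential f (p + t k *\<^sub>R W (t k))"
    and Q2: "(lam + t k * \<Delta>) *\<^sub>R V (t k) + W (t k) = d - \<Delta> *\<^sub>R u" for k
    using joint_prox_quotient[OF f lam tpos[of k] lamt[of k], where x = x and d = d]
    unfolding p_def u_def V_def W_def by simp_all
  have "norm (W (t k)) \<le> norm (d - \<Delta> *\<^sub>R u)" for k
  proof (rule norm_le_of_monotone[OF lamt _ Q2])
    have u: "u + t k *\<^sub>R 0 \<in> subdifferential f (p + t k *\<^sub>R 0)"
      using joint_prox_subgradient[OF f lam, of x] by (simp add: p_def u_def)
    show "0 \<le> V (t k) \<bullet> W (t k)"
      using subdifferential_quotient_monotone[OF Q1 u tpos] by simp
  qed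
  then have "bounded (range (\<lambda>k. W (t k)))" by (auto simp: bounded_iff)
  then obtain w r where r: "strict_mono (r :: nat \<Rightarrow> nat)" and w: "(\<lambda>k. W (t (r k))) \<longlonglongrightarrow> w"
    using bounded_imp_convergent_subsequence by (force simp: o_def)
  have tr: "(\<lambda>k. t (r k)) \<longlonglongrightarrow> 0"
    using LIMSEQ_subseq_LIMSEQ[OF t0 r] by (simp add: o_def)
  define v where "v = (1 / (lam + 0 * \<Delta>)) *\<^sub>R (d - \<Delta> *\<^sub>R u - w)"
  have "(\<lambda>k. V (t (r k))) \<longlonglongrightarrow> v"
    unfolding V_def v_def using lam by (intro tendsto_intros tr w) auto
  with w have WV: "(\<lambda>k. (W (t (r k)), V (t (r k)))) \<longlonglongrightarrow> (w, v)"
    by (rule tendsto_Pair)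
  have "down_to_zero (\<lambda>k. t (r k))" using tpos tr by (simp add: down_to_zero_def)
  moreover have "(p, u) + t (r k) *\<^sub>R (W (t (r k)), V (t (r k))) \<in> set_graph (subdifferential f)" for k
    using Q1 by (simp add: set_graph_def)
  ultimately have "v \<in> graphical_deriv (subdifferential f) p u w"
    using WV unfolding graphical_deriv_def tangent_cone_def by blast
  moreover have "lam *\<^sub>R v + w = d - \<Delta> *\<^sub>R u" using lam by (simp add: v_def)
  ultimately show thesis by (rule that)
qed

lemma has_dir_deriv_unique:
  assumes "has_dir_deriv F x d v" "has_dir_deriv F x d w"
  shows "v = w"
  using assms unfolding has_dir_deriv_def
  by (rule tendsto_unique[OF trivial_limit_at_right_real])

lemma dir_deriv_eqI: "has_dir_deriv F x d v \<Longrightarrow> dir_deriv F x d = v"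
  unfolding dir_deriv_def by (blast intro: has_dir_deriv_unique)

lemma mem_set_inverse_scale_plus_id:
  "w \<in> set_inverse (scale_plus_id lam D) e \<longleftrightarrow> (\<exists>v \<in> D w. lam *\<^sub>R v + w = e)"
  by (auto simp: set_inverse_def scale_plus_id_def)

lemma has_dir_deriv_joint_prox_fixed_parameter:
  "has_dir_deriv (joint_prox f) (x, lam) (d, 0) = has_dir_deriv (prox lam f) x d"
  by (simp add: fun_eq_iff has_dir_deriv_def joint_prox_def)

theorem corollary8:
  fixes f :: "'a::euclidean_space \<Rightarrow> ereal" and x :: 'a and lam :: real
  assumes f: "closed_proper_convex f"
    and lam: "lam > 0"
    and proto: "proto_differentiable (subdifferential f)
                  (joint_prox f (x, lam)) ((1 / lam) *\<^sub>R (x - joint_prox f (x, lam)))"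
  shows "dir_differentiable (joint_prox f) (x, lam) \<and>
    (\<forall>d \<Delta>.
       set_inverse
         (scale_plus_id lam
           (graphical_deriv (subdifferential f)
              (joint_prox f (x, lam)) ((1 / lam) *\<^sub>R (x - joint_prox f (x, lam)))))
         (d - \<Delta> *\<^sub>R ((1 / lam) *\<^sub>R (x - joint_prox f (x, lam))))
       = {dir_deriv (joint_prox f) (x, lam) (d, \<Delta>)}) \<and>
    dir_differentiable (prox lam f) x \<and>
    (\<forall>d.
       set_inverse
         (scale_plus_id lam
           (graphical_deriv (subdifferential f)
              (joint_prox f (x, lam)) ((1 / lam) *\<^sub>R (x - joint_prox f (x, lam)))))
         d
       = {dir_deriv (prox lam f) x d})"
proof -
  define p where "p = joint_prox f (x, lam)"
  define u where "u = (1 / lam) *\<^sub>R (x - p)"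
  define G where "G = graphical_deriv (subdifferential f) p u"
  have joint: "\<exists>w. set_inverse (scale_plus_id lam G) (d - \<Delta> *\<^sub>R u) = {w} \<and>
      has_dir_deriv (joint_prox f) (x, lam) (d, \<Delta>) w" for d \<Delta>
  proof -
    let ?I = "set_inverse (scale_plus_id lam G) (d - \<Delta> *\<^sub>R u)"
    have deriv: "has_dir_deriv (joint_prox f) (x, lam) (d, \<Delta>) w" if "w \<in> ?I" for w
      using that proto has_dir_deriv_joint_prox[OF f lam, of x _ w d \<Delta>]
      by (auto simp: mem_set_inverse_scale_plus_id G_def u_def p_def)
    obtain w v where "v \<in> G w" "lam *\<^sub>R v + w = d - \<Delta> *\<^sub>R u"
      using ex_graphical_deriv_solution[OF f lam, of x d \<Delta>] unfolding G_def u_def p_def by blast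
    then have "w \<in> ?I" by (auto simp: mem_set_inverse_scale_plus_id)
    then show ?thesis using deriv has_dir_deriv_unique by blast
  qed
  have fixed: "\<exists>w. set_inverse (scale_plus_id lam G) d = {w} \<and> has_dir_deriv (prox lam f) x d w" for d
    using joint[of d 0] by (simp add: has_dir_deriv_joint_prox_fixed_parameter)
  have "dir_differentiable (joint_prox f) (x, lam)"
    unfolding dir_differentiable_def using joint by (metis surj_pair)
  moreover have "dir_differentiable (prox lam f) x"
    unfolding dir_differentiable_def using fixed by blast
  moreover have "set_inverse (scale_plus_id lam G) (d - \<Delta> *\<^sub>R u)
      = {dir_deriv (joint_prox f) (x, lam) (d, \<Delta>)}" for d \<Delta>
    using joint[of d \<Delta>] dir_deriv_eqI by metis
  moreover have "set_inverse (scale_plus_id lam G) d = {dir_deriv (prox lam f) x d}" for d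
    using fixed[of d] dir_deriv_eqI by metis
  ultimately show ?thesis unfolding G_def u_def p_def by blast
qed

end
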